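(* Let $\{X_n\}$ be a Harris recurrent Markov chain on $\mathscr{X}$ that is $\psi$-irreducible, aperiodic and Feller, and such that the support of $\psi$ has nonempty interior. Let $A\in\mathscr{B}^+(\mathscr{X})$ and let $V^{(n)}:\mathscr{X}\to\mathbb{R}$, $n\ge1$, be functions with $\sup_{x\in A^c}V^{(n)}(x)<\infty$ for all $n\ge1$. Then $\{X_n\}$ is not ergodic if one of the following holds: (a) $\int_{A^c}V^{(n)}(y)P(x,\mathrm{d}y)\ge V^{(n)}(x)-1$ for all $x\in\mathscr{X}$ and $n\ge1$, and $\{x\in B:\sup_{n\ge1}V^{(n)}(x)=\infty\}\in\mathscr{B}^+(\mathscr{X})$ for some $B\in\mathscr{B}^+(\mathscr{X})$; (b) $\int_{A^c}V^{(n)}(y)P(x,\mathrm{d}y)\ge V^{(n)}(x)-1$ for all $x\in A^c$ and $n\ge1$, and $\{x\in B:\sup_{n\ge1}V^{(n)}(x)=\infty\}\in\mathscr{B}^+(\mathscr{X})$ for some $B\in\mathscr{B}^+(\mathscr{X})$ with $B\subset A^c$.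
   Context: $\mathscr{X}$ is a locally compact separable metric space with a countably generated $\sigma$-field $\mathscr{B}(\mathscr{X})$. $\{X_n\}_{n\ge0}$ is a homogeneous Markov chain on $\mathscr{X}$ with $n$-step kernels $P^n(x,A)=\mathbb{P}(X_n\in A\mid X_0=x)$ and $P=P^1$. The chain is $\psi$-irreducible if there is a $\sigma$-finite measure $\psi$ on $(\mathscr{X},\mathscr{B}(\mathscr{X}))$ such that $\sum_{n\ge1}P^n(x,A)>0$ for all $x\in\mathscr{X}$ whenever $\psi(A)>0$; throughout, $\psi$ is a maximal irreducibility measure (every irreducibility measure is absolutely continuous with respect to $\psi$), and $\mathscr{B}^+(\mathscr{X})=\{A\in\mathscr{B}(\mathscr{X}):\psi(A)>0\}$. Aperiodic and (weak) Feller have the standard meaning of Meyn-Tweedie. Functions are $\mathscr{B}(\mathscr{X})$-measurable. A set $C\in\mathscr{B}(\mathscr{X})$ is petite if there are a probability distribution $\{a_n\}$ on $\mathbb{Z}_+$ and a non-trivial measure $\nu_a$ on $\mathscr{B}(\mathscr{X})$ with $\sum_{n\ge0}a_nP^n(x,B)\ge\nu_a(B)$ for all $x\in C$, $B\in\mathscr{B}(\mathscr{X})$. $\tau_A^+=\inf\{n\ge1:X_n\in A\}$. Harris recurrent: $\mathbb{P}_x(\sum_{n\ge1}\mathbf{1}_{\{X_n\in A\}}=\infty)=1$ for all $x\in\mathscr{X}$, $A\in\mathscr{B}^+(\mathscr{X})$. Ergodic: Harris recurrent and there is a petite set $C\in\mathscr{B}^+(\mathscr{X})$ with $\sup_{x\in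 C}\mathbb{E}_x\tau_C^+<\infty$; equivalently, Harris recurrent and admitting an invariant probability measure. *)

theory Defs
  imports "HOL-Probability.Probability"
begin

text \<open>
  Throughout, \<open>Pr x\<close> is the law \<open>\<P>\<^sub>x\<close> of the chain \<open>X\<close> started at \<open>x\<close>, the state space is
  the whole type \<open>'a\<close>, and its \<open>\<sigma>\<close>-field is the Borel \<open>\<sigma>\<close>-field.
\<close>

definition nstep :: "('a::topological_space \<Rightarrow> 'w measure) \<Rightarrow> (nat \<Rightarrow> 'w \<Rightarrow> 'a) \<Rightarrow> nat \<Rightarrow> 'a \<Rightarrow> 'a measure"
  where "nstep Pr X n x = distr (Pr x) borel (X n)"

abbreviation trans_kernel :: "('a::topological_space \<Rightarrow> 'w measure) \<Rightarrow> (nat \<Rightarrow> 'w \<Rightarrow> 'a) \<Rightarrow> 'a \<Rightarrow> 'a measure"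
  where "trans_kernel Pr X \<equiv> nstep Pr X 1"

definition history :: "'w measure \<Rightarrow> (nat \<Rightarrow> 'w \<Rightarrow> 'a::topological_space) \<Rightarrow> nat \<Rightarrow> 'w measure"
  where "history \<Omega> X n =
    sigma (space \<Omega>) {X i -` B \<inter> space \<Omega> | i B. i \<le> n \<and> B \<in> sets borel}"

text \<open>
  Only the measurable space of \<open>\<Omega>\<close> matters.  The last assumption says that
  \<open>\<P>\<^sub>x(X\<^bsub>n+1\<^esub> \<in> B | X\<^sub>0, \<dots>, X\<^sub>n) = P(X\<^sub>n, B)\<close> almost surely, with one kernel \<open>P\<close> for all \<open>n\<close>.
\<close>

locale markov_chain =
  fixes \<Omega> :: "'w measure"
    and Pr :: "'a::{metric_space, second_countable_topology} \<Rightarrow> 'w measure"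
    and X :: "nat \<Rightarrow> 'w \<Rightarrow> 'a"
  assumes prob: "prob_space (Pr x)"
    and sets_Pr: "sets (Pr x) = sets \<Omega>"
    and X_measurable: "X n \<in> \<Omega> \<rightarrow>\<^sub>M borel"
    and kernel_measurable: "trans_kernel Pr X \<in> borel \<rightarrow>\<^sub>M prob_algebra borel"
    and start: "AE \<omega> in Pr x. X 0 \<omega> = x"
    and markov: "B \<in> sets borel \<Longrightarrow>
      AE \<omega> in Pr x. real_cond_exp (Pr x) (history \<Omega> X n) (\<lambda>\<omega>. indicator B (X (Suc n) \<omega>)) \<omega>
        = measure (trans_kernel Pr X (X n \<omega>)) B"

definition irreducibility_measure ::
    "('a::topological_space \<Rightarrow> 'w measure) \<Rightarrow> (nat \<Rightarrow> 'w \<Rightarrow> 'a) \<Rightarrow> 'a measure \<Rightarrow> bool"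
  where "irreducibility_measure Pr X \<phi> \<longleftrightarrow>
    sigma_finite_measure \<phi> \<and> sets \<phi> = sets borel \<and>
    (\<forall>A\<in>sets borel. emeasure \<phi> A > 0 \<longrightarrow>
      (\<forall>x. (\<Sum>n. emeasure (nstep Pr X (Suc n) x) A) > 0))"

definition maximal_irreducibility_measure ::
    "('a::topological_space \<Rightarrow> 'w measure) \<Rightarrow> (nat \<Rightarrow> 'w \<Rightarrow> 'a) \<Rightarrow> 'a measure \<Rightarrow> bool"
  where "maximal_irreducibility_measure Pr X \<psi> \<longleftrightarrow>
    irreducibility_measure Pr X \<psi> \<and>
    (\<forall>\<phi>. irreducibility_measure Pr X \<phi> \<longrightarrow> absolutely_continuous \<psi> \<phi>)"

definition Bplus :: "'a::topological_space measure \<Rightarrow> 'a set set"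
  where "Bplus \<psi> = {A \<in> sets borel. emeasure \<psi> A > 0}"

definition d_cycle ::
    "('a::topological_space \<Rightarrow> 'a measure) \<Rightarrow> 'a measure \<Rightarrow> nat \<Rightarrow> (nat \<Rightarrow> 'a set) \<Rightarrow> bool"
  where "d_cycle P \<psi> d D \<longleftrightarrow>
    d \<ge> 1 \<and> (\<forall>i<d. D i \<in> sets borel) \<and> disjoint_family_on D {..<d} \<and>
    (\<forall>i<d. \<forall>x\<in>D i. emeasure (P x) (D (Suc i mod d)) = 1) \<and>
    emeasure \<psi> (- (\<Union>i<d. D i)) = 0"

text \<open>The period is the largest length of a cycle, following Meyn and Tweedie.\<close>

definition is_period :: "('a::topological_space \<Rightarrow> 'a measure) \<Rightarrow> 'a measure \<Rightarrow> nat \<Rightarrow> bool"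
  where "is_period P \<psi> d \<longleftrightarrow>
    (\<exists>D. d_cycle P \<psi> d D) \<and> (\<forall>e D. d_cycle P \<psi> e D \<longrightarrow> e \<le> d)"

definition aperiodic :: "('a::topological_space \<Rightarrow> 'a measure) \<Rightarrow> 'a measure \<Rightarrow> bool"
  where "aperiodic P \<psi> \<longleftrightarrow> is_period P \<psi> 1"

definition feller :: "('a::topological_space \<Rightarrow> 'a measure) \<Rightarrow> bool"
  where "feller P \<longleftrightarrow>
    (\<forall>f::'a \<Rightarrow> real. continuous_on UNIV f \<and> bounded (range f) \<longrightarrow>
      continuous_on UNIV (\<lambda>x. \<integral>y. f y \<partial>P x))"

definition measure_support :: "'a::topological_space measure \<Rightarrow> 'a set"
  where "measure_support \<mu> = {x. \<forall>U. open U \<and> x \<in> U \<longrightarrow> emeasure \<mu> U > 0}"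

definition petite ::
    "('a::topological_space \<Rightarrow> 'w measure) \<Rightarrow> (nat \<Rightarrow> 'w \<Rightarrow> 'a) \<Rightarrow> 'a set \<Rightarrow> bool"
  where "petite Pr X C \<longleftrightarrow> C \<in> sets borel \<and>
    (\<exists>(a::nat pmf) (\<nu>::'a measure). sets \<nu> = sets borel \<and> emeasure \<nu> UNIV > 0 \<and>
      (\<forall>x\<in>C. \<forall>B\<in>sets borel.
        (\<Sum>n. ennreal (pmf a n) * emeasure (nstep Pr X n x) B) \<ge> emeasure \<nu> B))"

definition return_time :: "(nat \<Rightarrow> 'w \<Rightarrow> 'a) \<Rightarrow> 'a set \<Rightarrow> 'w \<Rightarrow> enat"
  where "return_time X A \<omega> = (INF n\<in>{n. n \<ge> 1 \<and> X n \<omega> \<in> A}. enat n)"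

definition harris_recurrent ::
    "('a::topological_space \<Rightarrow> 'w measure) \<Rightarrow> (nat \<Rightarrow> 'w \<Rightarrow> 'a) \<Rightarrow> 'a measure \<Rightarrow> bool"
  where "harris_recurrent Pr X \<psi> \<longleftrightarrow>
    (\<forall>x. \<forall>A\<in>Bplus \<psi>.
      \<P>(\<omega> in Pr x. (\<Sum>n. indicator A (X (Suc n) \<omega>)) = (\<infinity>::ennreal)) = 1)"

definition ergodic_chain ::
    "('a::topological_space \<Rightarrow> 'w measure) \<Rightarrow> (nat \<Rightarrow> 'w \<Rightarrow> 'a) \<Rightarrow> 'a measure \<Rightarrow> bool"
  where "ergodic_chain Pr X \<psi> \<longleftrightarrow> harris_recurrent Pr X \<psi> \<and>
    (\<exists>C\<in>Bplus \<psi>. petite Pr X C \<and>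
      (SUP x\<in>C. \<integral>\<^sup>+\<omega>. ennreal_of_enat (return_time X C \<omega>) \<partial>Pr x) < \<infinity>)"

text \<open>
  The integral of a function over a set with values in \<open>[-\<infinity>, \<infinity>]\<close>, as positive part minus negative
  part (\<open>ennreal\<close> truncates negative reals to \<open>0\<close>).  It is meaningful when one of the parts is finite.
  For functions bounded above on \<open>S\<close> and finite \<open>M\<close> the positive part is finite, and the value
  \<open>-\<infinity>\<close> may occur, whereas the Bochner integral would then be \<open>0\<close>.
\<close>

definition ext_set_integral :: "'a measure \<Rightarrow> 'a set \<Rightarrow> ('a \<Rightarrow> real) \<Rightarrow> ereal"
  where "ext_set_integral M S f =
    enn2ereal (\<integral>\<^sup>+y\<in>S. ennreal (f y) \<partial>M) - enn2ereal (\<integral>\<^sup>+y\<in>S. ennreal (- f y) \<partial>M)"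

end

theory Submission
  imports Defs
begin

text \<open>
  Iterating \<open>V \<le> 1 + P (1\<^bsub>-A\<^esub> V)\<close> along the chain killed in \<open>A\<close> gives
  \<open>V x \<le> E\<^sub>x \<tau>\<^sub>A + sup V \<cdot> P\<^sub>x (\<tau>\<^sub>A > k)\<close>, and the last term vanishes by Harris recurrence.
  Hence \<open>E\<^sub>x \<tau>\<^sub>A = \<infinity>\<close> on a set that \<open>\<psi>\<close> charges.  If the chain were ergodic with petite set \<open>C\<close>, then
  petiteness would let \<open>A\<close> be hit from \<open>C\<close> within a fixed number of steps with probability bounded
  away from \<open>0\<close>, so that \<open>E\<^sub>x \<tau>\<^sub>A \<le> E\<^sub>x \<tau>\<^sub>C + const\<close>; but the set where \<open>E\<^sub>x \<tau>\<^sub>C = \<infinity>\<close> is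
  unreachable from \<open>C\<close>, and irreducibility makes it \<open>\<psi>\<close>-null.
\<close>

section \<open>Kernels killed on a set\<close>

text \<open>
  For the chain, \<open>taboo_iter K A n f x\<close> is \<open>E\<^sub>x [f (X\<^sub>n); \<tau>\<^sub>A > n]\<close>; with \<open>A = {}\<close> it is \<open>P\<^sup>n f x\<close>.
  Summing the tails \<open>P\<^sub>x (\<tau>\<^sub>A > i)\<close> gives \<open>E\<^sub>x (min \<tau>\<^sub>A k)\<close> and \<open>E\<^sub>x \<tau>\<^sub>A\<close>.
\<close>

definition taboo :: "('a::topological_space \<Rightarrow> 'a measure) \<Rightarrow> 'a set \<Rightarrow> ('a \<Rightarrow> ennreal) \<Rightarrow> 'a \<Rightarrow> ennreal"
  where "taboo K A f x = (\<integral>\<^sup>+y\<in>-A. f y \<partial>K x)"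

abbreviation taboo_iter :: "('a::topological_space \<Rightarrow> 'a measure) \<Rightarrow> 'a set \<Rightarrow> nat \<Rightarrow> ('a \<Rightarrow> ennreal) \<Rightarrow> 'a \<Rightarrow> ennreal"
  where "taboo_iter K A n \<equiv> taboo K A ^^ n"

definition truncated_return :: "('a::topological_space \<Rightarrow> 'a measure) \<Rightarrow> 'a set \<Rightarrow> nat \<Rightarrow> 'a \<Rightarrow> ennreal"
  where "truncated_return K A k x = (\<Sum>i<k. taboo_iter K A i (\<lambda>_. 1) x)"

definition mean_return :: "('a::topological_space \<Rightarrow> 'a measure) \<Rightarrow> 'a set \<Rightarrow> 'a \<Rightarrow> ennreal"
  where "mean_return K A x = (\<Sum>i. taboo_iter K A i (\<lambda>_. 1) x)"

locale borel_kernel =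
  fixes K :: "'a::topological_space \<Rightarrow> 'a measure"
  assumes kernel: "K \<in> borel \<rightarrow>\<^sub>M prob_algebra borel"
begin

lemma prob_space_kernel: "prob_space (K x)"
  using measurable_space[OF kernel, of x] by (simp add: space_prob_algebra)

lemma sets_kernel_borel [measurable_cong, simp]: "sets (K x) = sets borel"
  using measurable_space[OF kernel, of x] by (simp add: space_prob_algebra)

lemma emeasure_kernel_UNIV: "emeasure (K x) UNIV = 1"
  using prob_space.emeasure_space_1[OF prob_space_kernel, of x] sets_eq_imp_space_eq[OF sets_kernel_borel, of x]
  by simp

lemma taboo_measurable [measurable]:
  assumes [measurable]: "f \<in> borel_measurable borel" "A \<in> sets borel"
  shows "taboo K A f \<in> borel_measurable borel"
proof -
  have [measurable]: "K \<in> borel \<rightarrow>\<^sub>M subprob_algebra borel"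
    using kernel by (rule measurable_prob_algebraD)
  show ?thesis
    unfolding taboo_def by measurable
qed

lemma taboo_iter_measurable [measurable]:
  assumes "f \<in> borel_measurable borel" "A \<in> sets borel"
  shows "taboo_iter K A n f \<in> borel_measurable borel"
  by (induction n) (auto intro: taboo_measurable assms)

lemma truncated_return_measurable [measurable]:
  assumes [measurable]: "A \<in> sets borel"
  shows "truncated_return K A k \<in> borel_measurable borel"
  unfolding truncated_return_def[abs_def] by measurable

lemma mean_return_measurable [measurable]:
  assumes [measurable]: "A \<in> sets borel"
  shows "mean_return K A \<in> borel_measurable borel"
  unfolding mean_return_def[abs_def] by measurable

section \<open>Monotonicity, linearity and mass of the killed iterates\<close>

lemma taboo_mono: "(\<And>x. x \<notin> A \<Longrightarrow> f x \<le> g x) \<Longrightarrow> taboo K A f x \<le> taboo K A g x"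
  unfolding taboo_def by (intro nn_integral_mono) (auto simp: indicator_def)

lemma taboo_iter_mono: "(\<And>x. f x \<le> g x) \<Longrightarrow> taboo_iter K A n f x \<le> taboo_iter K A n g x"
  by (induction n arbitrary: x) (auto intro: taboo_mono)

lemma taboo_add:
  assumes [measurable]: "f \<in> borel_measurable borel" "g \<in> borel_measurable borel" "A \<in> sets borel"
  shows "taboo K A (\<lambda>x. f x + g x) x = taboo K A f x + taboo K A g x"
  unfolding taboo_def by (subst nn_integral_add[symmetric]) (auto simp: distrib_right)

lemma taboo_iter_add:
  assumes "f \<in> borel_measurable borel" "g \<in> borel_measurable borel" "A \<in> sets borel"
  shows "taboo_iter K A n (\<lambda>x. f x + g x) x = taboo_iter K A n f x + taboo_iter K A n g x"
proof (induction n arbitrary: x)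
  case (Suc n)
  then have "taboo_iter K A n (\<lambda>x. f x + g x) = (\<lambda>x. taboo_iter K A n f x + taboo_iter K A n g x)"
    by auto
  then show ?case
    by (simp add: taboo_add taboo_iter_measurable assms)
qed simp

lemma taboo_cmult:
  assumes [measurable]: "f \<in> borel_measurable borel" "A \<in> sets borel"
  shows "taboo K A (\<lambda>x. c * f x) x = c * taboo K A f x"
  unfolding taboo_def by (subst nn_integral_cmult[symmetric]) (auto simp: mult.assoc)

lemma taboo_iter_cmult:
  assumes "f \<in> borel_measurable borel" "A \<in> sets borel"
  shows "taboo_iter K A n (\<lambda>x. c * f x) x = c * taboo_iter K A n f x"
proof (induction n arbitrary: x)
  case (Suc n)
  then have "taboo_iter K A n (\<lambda>x. c * f x) = (\<lambda>x. c * taboo_iter K A n f x)"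
    by auto
  then show ?case
    by (simp add: taboo_cmult taboo_iter_measurable assms)
qed simp

lemma taboo_iter_const:
  assumes "A \<in> sets borel"
  shows "taboo_iter K A n (\<lambda>_. c) x = c * taboo_iter K A n (\<lambda>_. 1) x"
  using taboo_iter_cmult[where f = "\<lambda>_. 1" and A = A and n = n and c = c and x = x] assms by simp

lemma taboo_iter_le_iter: "taboo_iter K A n f x \<le> taboo_iter K {} n f x"
proof (induction n arbitrary: x)
  case (Suc n)
  have "taboo K A (taboo_iter K A n f) x \<le> taboo K {} (taboo_iter K A n f) x"
    unfolding taboo_def by (intro nn_integral_mono) (auto simp: indicator_def)
  also have "\<dots> \<le> taboo K {} (taboo_iter K {} n f) x"
    by (intro taboo_mono Suc)
  finally show ?case by simp
qed simp

lemma iter_const: "taboo_iter K {} n (\<lambda>_. c) x = c"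
proof (induction n arbitrary: x)
  case (Suc n)
  have "taboo_iter K {} n (\<lambda>_. c) = (\<lambda>_. c)"
    using Suc by auto
  moreover have "taboo K {} (\<lambda>_. c) x = c"
    by (simp add: taboo_def emeasure_kernel_UNIV sets_eq_imp_space_eq[OF sets_kernel_borel])
  ultimately show ?case
    by simp
qed simp

lemma taboo_iter_one_le_1: "taboo_iter K A n (\<lambda>_. 1) x \<le> 1"
  using taboo_iter_le_iter[where f = "\<lambda>_. 1" and A = A and n = n and x = x] by (simp add: iter_const)

lemma taboo_iter_one_decseq:
  assumes "m \<le> n"
  shows "taboo_iter K A n (\<lambda>_. 1) x \<le> taboo_iter K A m (\<lambda>_. 1) x"
proof -
  have "taboo_iter K A n (\<lambda>_. 1) x = taboo_iter K A m (taboo_iter K A (n - m) (\<lambda>_. 1)) x"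
    using assms by (metis funpow_add le_add_diff_inverse comp_apply)
  also have "\<dots> \<le> taboo_iter K A m (\<lambda>_. 1) x"
    by (intro taboo_iter_mono taboo_iter_one_le_1)
  finally show ?thesis .
qed

text \<open>A visit to \<open>A\<close> at time \<open>k\<close> rules out
  \<open>\<tau>\<^sub>A > n\<close>, so the two terms are probabilities of disjoint events. The
  bound \<open>1 \<le> k\<close> matters because killing never tests the starting point.\<close>

lemma taboo_iter_one_add_iter_indicator_le_1:
  assumes [measurable]: "A \<in> sets borel" and "1 \<le> k" "k \<le> n"
  shows "taboo_iter K A n (\<lambda>_. 1) x + taboo_iter K {} k (indicator A) x \<le> 1"
proof -
  obtain j where j: "k = Suc j"
    using \<open>1 \<le> k\<close> by (cases k) auto
  have eq: "taboo K A (\<lambda>_. 1) = taboo K {} (indicator (- A))"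
    by (auto simp: taboo_def fun_eq_iff)
  have "taboo_iter K A n (\<lambda>_. 1) x \<le> taboo_iter K A k (\<lambda>_. 1) x"
    using \<open>k \<le> n\<close> by (rule taboo_iter_one_decseq)
  also have "\<dots> = taboo_iter K A j (taboo K {} (indicator (- A))) x"
    by (simp add: j eq[symmetric] funpow_swap1)
  also have "\<dots> \<le> taboo_iter K {} j (taboo K {} (indicator (- A))) x"
    by (rule taboo_iter_le_iter)
  also have "\<dots> = taboo_iter K {} k (indicator (- A)) x"
    by (simp add: j funpow_swap1)
  finally have "taboo_iter K A n (\<lambda>_. 1) x + taboo_iter K {} k (indicator A) x
      \<le> taboo_iter K {} k (indicator (- A)) x + taboo_iter K {} k (indicator A) x"
    by (rule add_right_mono)
  also have "\<dots> = taboo_iter K {} k (\<lambda>x. indicator (- A) x + indicator A x) x"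
    by (rule taboo_iter_add[symmetric]) auto
  also have "(\<lambda>x. indicator (- A) x + indicator A x) = (\<lambda>_. 1::ennreal)"
    by (auto simp: indicator_def fun_eq_iff)
  finally show ?thesis
    by (simp add: iter_const)
qed

section \<open>Truncated and full mean return times\<close>

lemma truncated_return_0 [simp]: "truncated_return K A 0 x = 0"
  by (simp add: truncated_return_def)

text \<open>First-step decomposition: one step is always spent, and the clock runs on only if that
  step avoids \<open>A\<close>.\<close>

lemma truncated_return_Suc:
  assumes [measurable]: "A \<in> sets borel"
  shows "truncated_return K A (Suc k) x = 1 + taboo K A (truncated_return K A k) x"
proof -
  have "taboo K A (truncated_return K A k) x = (\<Sum>i<k. taboo_iter K A (Suc i) (\<lambda>_. 1) x)"
  proof (induction k)
    case 0
    show ?case by (simp add: taboo_def)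
  next
    case (Suc k)
    have "truncated_return K A (Suc k) = (\<lambda>x. truncated_return K A k x + taboo_iter K A k (\<lambda>_. 1) x)"
      by (simp add: truncated_return_def[abs_def])
    then show ?case
      using Suc by (simp add: taboo_add taboo_iter_measurable truncated_return_measurable)
  qed
  then show ?thesis
    unfolding truncated_return_def[of _ _ "Suc k"] by (subst sum.lessThan_Suc_shift) simp
qed

lemma truncated_return_mono: "j \<le> k \<Longrightarrow> truncated_return K A j x \<le> truncated_return K A k x"
  unfolding truncated_return_def by (rule sum_mono2) auto

lemma truncated_return_le: "truncated_return K A k x \<le> of_nat k"
  unfolding truncated_return_def using sum_bounded_above[of "{..<k}" "\<lambda>i. taboo_iter K A i (\<lambda>_. 1) x" 1]
  by (simp add: taboo_iter_one_le_1)

text \<open>Restart at time \<open>n\<close>: the time beyond \<open>n\<close> counts only on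
  \<open>\<tau>\<^sub>A > n\<close>, where it is the truncated return time of the chain started at
  \<open>X\<^sub>n\<close>.\<close>

lemma truncated_return_add:
  assumes [measurable]: "A \<in> sets borel"
  shows "truncated_return K A (n + k) x = truncated_return K A n x + taboo_iter K A n (truncated_return K A k) x"
proof (induction n arbitrary: x)
  case (Suc n)
  have "truncated_return K A (n + k) = (\<lambda>x. truncated_return K A n x + taboo_iter K A n (truncated_return K A k) x)"
    using Suc by auto
  then show ?case
    by (simp add: truncated_return_Suc taboo_add add.assoc)
qed simp

lemma mean_return_eq_SUP: "mean_return K A x = (SUP k. truncated_return K A k x)"
  unfolding mean_return_def truncated_return_def by (rule suminf_eq_SUP)

lemma truncated_le_mean_return: "truncated_return K A k x \<le> mean_return K A x"
  unfolding mean_return_eq_SUP by (rule SUP_upper) simp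

text \<open>The first-step equation for \<open>E\<^sub>x \<tau>\<^sub>A\<close>, valid also when the
  mean is infinite.\<close>

lemma mean_return_unfold:
  assumes [measurable]: "A \<in> sets borel"
  shows "mean_return K A x = 1 + taboo K A (mean_return K A) x"
proof -
  have "taboo K A (mean_return K A) x = (\<integral>\<^sup>+y. (\<Sum>i. taboo_iter K A i (\<lambda>_. 1) y * indicator (- A) y) \<partial>K x)"
    unfolding taboo_def mean_return_def by simp
  also have "\<dots> = (\<Sum>i. taboo_iter K A (Suc i) (\<lambda>_. 1) x)"
    by (subst nn_integral_suminf) (auto simp: taboo_def)
  finally show ?thesis
    unfolding mean_return_def[of _ _ x]
    by (subst suminf_offset[of _ 1]) (auto simp: add.commute)
qed

section \<open>Comparison of the mean return times to two sets\<close>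

text \<open>One unkilled step raises the mean return time to \<open>C\<close> by at most
  \<open>M\<close>: successors outside \<open>C\<close> are controlled by the first-step equation,
  those in \<open>C\<close> by \<open>bound\<close>. This bounds the wait for \<open>C\<close> after
  a fixed number of steps.\<close>

lemma iter_mean_return_le:
  assumes [measurable]: "C \<in> sets borel" and bound: "\<And>x. x \<in> C \<Longrightarrow> mean_return K C x \<le> M"
  shows "taboo_iter K {} n (mean_return K C) x \<le> mean_return K C x + of_nat n * M"
proof (induction n arbitrary: x)
  case (Suc n)
  have step: "taboo K {} (mean_return K C) x \<le> mean_return K C x + M" for x
  proof -
    have "taboo K {} (mean_return K C) x \<le> taboo K {} (\<lambda>y. mean_return K C y * indicator (- C) y + M) x"
      by (rule taboo_mono) (auto simp: indicator_def bound)
    also have "\<dots> = taboo K {} (\<lambda>y. mean_return K C y * indicator (- C) y) x + taboo K {} (\<lambda>_. M) x"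
      by (rule taboo_add) auto
    also have "taboo K {} (\<lambda>y. mean_return K C y * indicator (- C) y) x = taboo K C (mean_return K C) x"
      by (simp add: taboo_def)
    also have "taboo K {} (\<lambda>_. M) x = M"
      using iter_const[of 1] by simp
    also have "taboo K C (mean_return K C) x \<le> mean_return K C x"
      using mean_return_unfold[OF assms(1), of x] by simp
    finally show ?thesis
      by (simp add: add_right_mono)
  qed
  have "taboo_iter K {} (Suc n) (mean_return K C) x \<le> taboo K {} (\<lambda>y. mean_return K C y + of_nat n * M) x"
    by (simp add: taboo_mono Suc)
  also have "\<dots> = taboo K {} (mean_return K C) x + of_nat n * M"
    using iter_const[of 1 "of_nat n * M"] by (simp add: taboo_add)
  also have "\<dots> \<le> (mean_return K C x + M) + of_nat n * M"
    by (intro add_right_mono step)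
  finally show ?case
    by (simp add: algebra_simps)
qed simp

text \<open>Wait for the next visit to \<open>C\<close> and restart there, at worst from the least
  favourable point of \<open>C\<close>. In the induction a successor in \<open>C\<close> is absorbed
  by the supremum, one outside \<open>C\<close> by the induction hypothesis.\<close>

lemma truncated_return_le_mean_return_plus_SUP:
  assumes [measurable]: "A \<in> sets borel" "C \<in> sets borel"
  shows "truncated_return K A k x \<le> mean_return K C x + (SUP y\<in>C. truncated_return K A k y)"
proof (induction k arbitrary: x)
  case (Suc k)
  let ?s = "\<lambda>k. SUP y\<in>C. truncated_return K A k y"
  have "taboo K A (truncated_return K A k) x \<le> taboo K {} (\<lambda>y. mean_return K C y * indicator (- C) y + ?s k) x"
  proof -
    have "truncated_return K A k y \<le> mean_return K C y * indicator (- C) y + ?s k" for y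
      using Suc[of y] by (cases "y \<in> C") (auto intro: SUP_upper)
    then have "taboo K A (truncated_return K A k) x \<le> taboo K A (\<lambda>y. mean_return K C y * indicator (- C) y + ?s k) x"
      by (intro taboo_mono)
    also have "\<dots> \<le> taboo K {} (\<lambda>y. mean_return K C y * indicator (- C) y + ?s k) x"
      using taboo_iter_le_iter[where n = 1] by simp
    finally show ?thesis .
  qed
  also have "\<dots> = taboo K C (mean_return K C) x + ?s k"
    using iter_const[of 1 "?s k"] by (subst taboo_add) (auto simp: taboo_def)
  finally have "truncated_return K A (Suc k) x \<le> 1 + (taboo K C (mean_return K C) x + ?s k)"
    by (simp add: truncated_return_Suc)
  also have "\<dots> = mean_return K C x + ?s k"
    using mean_return_unfold[OF assms(2), of x] by (simp add: add.assoc)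
  also have "\<dots> \<le> mean_return K C x + ?s (Suc k)"
    by (intro add_left_mono SUP_mono') (auto intro: truncated_return_mono)
  finally show ?case .
qed simp

text \<open>
  Wait \<open>N\<close> steps and then for the next visit to \<open>C\<close>: each such cycle started in \<open>C\<close> has bounded
  mean length and misses \<open>A\<close> with probability at most \<open>q < 1\<close>.  The truncation makes the
  resulting inequality for the supremum over \<open>C\<close> solvable.
\<close>

lemma mean_return_comparison:
  assumes [measurable]: "A \<in> sets borel" "C \<in> sets borel"
    and bound: "\<And>x. x \<in> C \<Longrightarrow> mean_return K C x \<le> M" and "M < \<top>"
    and miss: "\<And>x. x \<in> C \<Longrightarrow> taboo_iter K A N (\<lambda>_. 1) x \<le> q" and "q < 1"
  shows "\<exists>c<\<top>. \<forall>x. mean_return K A x \<le> mean_return K C x + c"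
proof -
  define s where "s k = (SUP y\<in>C. truncated_return K A k y)" for k
  \<comment> \<open>Bound for the mean length of a cycle from \<open>C\<close>: \<open>N\<close>
    steps, then the mean wait for \<open>C\<close> as seen at time \<open>N\<close>.\<close>
  define R where "R = of_nat N + (M + of_nat N * M)"
  have R: "R < \<top>"
    using \<open>M < \<top>\<close> by (auto simp: R_def ennreal_mult_less_top of_nat_less_top)
  have s_le: "s k \<le> R / (1 - q)" for k
  proof -
    \<comment> \<open>Finiteness of \<open>s k\<close> allows \<open>s k * q\<close> to be cancelled
      at the end.\<close>
    have "s k \<le> of_nat k"
      unfolding s_def by (rule SUP_least) (rule truncated_return_le)
    then have s_fin: "s k < \<top>"
      by (rule le_less_trans) (rule of_nat_less_top)
    \<comment> \<open>Split at time \<open>N\<close>. A fresh start with cost at most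
      \<open>s k\<close> is paid only on \<open>\<tau>\<^sub>A > N\<close>, which has probability at
      most \<open>q\<close>.\<close>
    have "truncated_return K A k x \<le> R + s k * q" if "x \<in> C" for x
    proof -
      have "truncated_return K A k x \<le> truncated_return K A (N + k) x"
        by (rule truncated_return_mono) simp
      also have "\<dots> = truncated_return K A N x + taboo_iter K A N (truncated_return K A k) x"
        by (rule truncated_return_add) simp
      also have "\<dots> \<le> of_nat N + taboo_iter K A N (\<lambda>y. mean_return K C y + s k) x"
        unfolding s_def
        by (intro add_mono truncated_return_le taboo_iter_mono truncated_return_le_mean_return_plus_SUP) auto
      also have "\<dots> = of_nat N + (taboo_iter K A N (mean_return K C) x + s k * taboo_iter K A N (\<lambda>_. 1) x)"
        by (simp add: taboo_iter_add taboo_iter_const[where c = "s k"])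
      also have "\<dots> \<le> of_nat N + ((M + of_nat N * M) + s k * q)"
      proof (intro add_left_mono add_mono mult_left_mono miss that)
        have "taboo_iter K A N (mean_return K C) x \<le> mean_return K C x + of_nat N * M"
          using taboo_iter_le_iter iter_mean_return_le[OF _ bound] by (rule order_trans) simp_all
        also have "\<dots> \<le> M + of_nat N * M"
          by (intro add_right_mono bound that)
        finally show "taboo_iter K A N (mean_return K C) x \<le> M + of_nat N * M" .
      qed simp
      finally show ?thesis
        by (simp add: R_def add.assoc)
    qed
    then have "s k \<le> R + s k * q"
      unfolding s_def[of k] by (intro SUP_least) (auto simp: s_def)
    moreover have "s k = s k * q + s k * (1 - q)"
      using \<open>q < 1\<close> by (simp add: distrib_left[symmetric] add_diff_inverse_ennreal)
    ultimately have "s k * q + s k * (1 - q) \<le> s k * q + R"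
      by (simp add: add.commute)
    moreover have "s k * q < \<top>"
      using s_fin \<open>q < 1\<close> by (auto simp: ennreal_mult_less_top intro: less_trans)
    ultimately have "s k * (1 - q) \<le> R"
      by (auto simp: ennreal_add_left_cancel_le)
    then have "s k * (1 - q) / (1 - q) \<le> R / (1 - q)"
      by (rule divide_right_mono_ennreal)
    moreover have "1 - q \<noteq> 0" "1 - q \<noteq> \<top>"
      using \<open>q < 1\<close> by (auto simp: diff_eq_0_iff_ennreal)
    ultimately show ?thesis
      by (simp add: mult_divide_eq_ennreal)
  qed
  show ?thesis
  proof (intro exI[of _ "R / (1 - q)"] conjI allI)
    show "R / (1 - q) < \<top>"
      using R \<open>q < 1\<close> by (auto simp: ennreal_divide_eq_top_iff less_top[symmetric] diff_eq_0_iff_ennreal)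
    show "mean_return K A x \<le> mean_return K C x + R / (1 - q)" for x
      unfolding mean_return_eq_SUP[of A]
    proof (rule SUP_least)
      fix k
      have "truncated_return K A k x \<le> mean_return K C x + s k"
        unfolding s_def by (rule truncated_return_le_mean_return_plus_SUP) auto
      also have "\<dots> \<le> mean_return K C x + R / (1 - q)"
        by (intro add_left_mono s_le)
      finally show "truncated_return K A k x \<le> mean_return K C x + R / (1 - q)" .
    qed
  qed
qed

text \<open>Finiteness passes to almost every successor: outside \<open>C\<close> because the
  integral in the first-step equation is finite, in \<open>C\<close> by \<open>fin\<close>.\<close>

lemma iter_infinite_mean_return_eq_0:
  assumes [measurable]: "C \<in> sets borel"
    and fin: "\<And>x. x \<in> C \<Longrightarrow> mean_return K C x < \<top>"
    and "mean_return K C x < \<top>"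
  shows "taboo_iter K {} n (indicator {y. mean_return K C y = \<top>}) x = 0"
  using \<open>mean_return K C x < \<top>\<close>
proof (induction n arbitrary: x)
  case (Suc n)
  have "taboo K C (mean_return K C) x < \<top>"
    using Suc.prems mean_return_unfold[OF assms(1), of x] by simp
  then have "AE y in K x. mean_return K C y * indicator (- C) y \<noteq> \<infinity>"
    unfolding taboo_def by (intro nn_integral_noteq_infinite) (auto simp: less_top)
  then have "AE y in K x. taboo_iter K {} n (indicator {y. mean_return K C y = \<top>}) y = 0"
  proof eventually_elim
    case (elim y)
    then have "mean_return K C y < \<top>"
      by (cases "y \<in> C") (auto simp: fin less_top)
    then show ?case
      by (rule Suc.IH)
  qed
  then have "(\<integral>\<^sup>+y. taboo_iter K {} n (indicator {y. mean_return K C y = \<top>}) y \<partial>K x) = 0"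
    by (subst nn_integral_0_iff_AE) (auto intro!: taboo_iter_measurable borel_measurable_indicator)
  then show ?case
    by (simp add: taboo_def[of _ _ "taboo_iter K {} n _"])
qed auto

section \<open>Lower bounds for mean return times from drift\<close>

text \<open>Each use of the drift inequality adds one tail probability. The inequality at
  \<open>x\<close> is a separate assumption so that \<open>x\<close> may lie in \<open>A\<close>;
  since \<open>W\<close> is bounded only off \<open>A\<close>, at least one killed step precedes the
  bound, whence \<open>Suc k\<close>.\<close>

lemma le_truncated_return_plus:
  assumes [measurable]: "A \<in> sets borel"
    and drift: "\<And>x. x \<notin> A \<Longrightarrow> W x \<le> 1 + taboo K A W x"
    and bound: "\<And>x. x \<notin> A \<Longrightarrow> W x \<le> M"
    and "W x \<le> 1 + taboo K A W x"
  shows "W x \<le> truncated_return K A (Suc k) x + M * taboo_iter K A (Suc k) (\<lambda>_. 1) x"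
proof -
  have step: "W x \<le> truncated_return K A (Suc k) x + M * taboo_iter K A (Suc k) (\<lambda>_. 1) x"
    if W: "W x \<le> 1 + taboo K A W x"
      and le: "\<And>y. y \<notin> A \<Longrightarrow> W y \<le> truncated_return K A k y + M * taboo_iter K A k (\<lambda>_. 1) y"
    for x k
  proof -
    have "taboo K A W x \<le> taboo K A (\<lambda>y. truncated_return K A k y + M * taboo_iter K A k (\<lambda>_. 1) y) x"
      by (intro taboo_mono le)
    also have "\<dots> = taboo K A (truncated_return K A k) x + M * taboo_iter K A (Suc k) (\<lambda>_. 1) x"
      by (simp add: taboo_add taboo_cmult)
    finally have "1 + taboo K A W x \<le> 1 + (taboo K A (truncated_return K A k) x + M * taboo_iter K A (Suc k) (\<lambda>_. 1) x)"
      by (rule add_left_mono)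
    with W have "W x \<le> 1 + (taboo K A (truncated_return K A k) x + M * taboo_iter K A (Suc k) (\<lambda>_. 1) x)"
      by (rule order_trans)
    then show ?thesis
      by (simp add: truncated_return_Suc add.assoc)
  qed
  \<comment> \<open>Off \<open>A\<close> the induction can start at \<open>k = 0\<close>, where the
    claim is \<open>bound\<close>.\<close>
  have "W y \<le> truncated_return K A k y + M * taboo_iter K A k (\<lambda>_. 1) y" if "y \<notin> A" for y k
    using that by (induction k arbitrary: y) (auto simp: bound simp del: funpow.simps(2) intro!: step drift)
  then show ?thesis
    using step assms(4) by blast
qed

text \<open>Let \<open>k\<close> tend to infinity: the remainder is a finite constant times the
  vanishing survival probability.\<close>

lemma le_mean_return:
  assumes [measurable]: "A \<in> sets borel"
    and drift: "\<And>x. x \<notin> A \<Longrightarrow> W x \<le> 1 + taboo K A W x"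
    and bound: "\<And>x. x \<notin> A \<Longrightarrow> W x \<le> M" and "M < \<top>"
    and "W x \<le> 1 + taboo K A W x"
    and recurrent: "(\<lambda>k. taboo_iter K A k (\<lambda>_. 1) x) \<longlonglongrightarrow> 0"
  shows "W x \<le> mean_return K A x"
proof -
  have "(\<lambda>k. mean_return K A x + M * taboo_iter K A (Suc k) (\<lambda>_. 1) x) \<longlonglongrightarrow> mean_return K A x + M * 0"
    using \<open>M < \<top>\<close> by (intro tendsto_add tendsto_const ennreal_tendsto_cmult LIMSEQ_Suc recurrent) auto
  moreover have "W x \<le> mean_return K A x + M * taboo_iter K A (Suc k) (\<lambda>_. 1) x" for k
    by (rule order_trans[OF le_truncated_return_plus[OF assms(1) drift bound assms(5)]])
       (auto intro: add_right_mono truncated_le_mean_return)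
  ultimately show ?thesis
    by (intro LIMSEQ_le_const[of _ "mean_return K A x"]) auto
qed

section \<open>Uniform hitting from a petite set\<close>

text \<open>The measure \<open>\<nu>\<close> charges a set from which \<open>A\<close> is hit at a
  fixed time with probability bounded below. Up to a small tail the sampling law \<open>a\<close>
  lives on finitely many times, so this set, and then \<open>A\<close>, is reached from all of
  \<open>C\<close> within one common horizon.\<close>

lemma uniform_hitting_of_petite:
  fixes a :: "nat pmf" and \<nu> :: "'a measure"
  assumes [measurable]: "A \<in> sets borel"
    and sets_\<nu>: "sets \<nu> = sets borel" and "emeasure \<nu> UNIV > 0"
    and minor: "\<And>x B. x \<in> C \<Longrightarrow> B \<in> sets borel \<Longrightarrow>
      emeasure \<nu> B \<le> (\<Sum>n. ennreal (pmf a n) * taboo_iter K {} n (indicator B) x)"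
    and reach: "\<And>y. (\<Sum>n. taboo_iter K {} (Suc n) (indicator A) y) > 0"
  shows "\<exists>N q. q < 1 \<and> (\<forall>x\<in>C. taboo_iter K A N (\<lambda>_. 1) x \<le> q)"
proof -
  \<comment> \<open>By \<open>reach\<close> these countably many sets cover the space, so
    \<open>\<nu>\<close> charges one of them.\<close>
  define B where "B m j = {y. taboo_iter K {} (Suc m) (indicator A) y > ennreal (inverse (real (Suc j)))}" for m j
  have [measurable]: "B m j \<in> sets borel" for m j
  proof -
    have [measurable]: "taboo_iter K {} (Suc m) (indicator A) \<in> borel_measurable borel"
      by (rule taboo_iter_measurable) auto
    have "B m j = {y\<in>space borel. taboo_iter K {} (Suc m) (indicator A) y > ennreal (inverse (real (Suc j)))}"
      unfolding B_def by simp
    also have "\<dots> \<in> sets borel"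
      by measurable
    finally show ?thesis .
  qed
  have "\<exists>m j. emeasure \<nu> (B m j) > 0"
  proof (rule ccontr)
    assume "\<not> ?thesis"
    then have "emeasure \<nu> (\<Union>m. \<Union>j. B m j) = 0"
      by (intro emeasure_UN_eq_0) (auto simp: sets_\<nu>)
    moreover have "(\<Union>m. \<Union>j. B m j) = UNIV"
    proof (intro set_eqI iffI UNIV_I)
      fix y
      have "\<exists>m. taboo_iter K {} (Suc m) (indicator A) y > 0"
      proof (rule ccontr)
        assume "\<not> ?thesis"
        then have "taboo_iter K {} (Suc m) (indicator A) y = 0" for m
          by (simp only: not_ex not_gr_zero)
        then show False
          using reach[of y] by (simp del: funpow.simps)
      qed
      then obtain m where "taboo_iter K {} (Suc m) (indicator A) y > 0"
        by blast
      then obtain e where "e > 0" "e < taboo_iter K {} (Suc m) (indicator A) y"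
        using dense by blast
      moreover obtain e' where "e = ennreal e'"
        using calculation by (cases e) auto
      moreover obtain j where "inverse (real (Suc j)) < e'"
        using calculation reals_Archimedean by (metis ennreal_less_zero_iff)
      ultimately have "ennreal (inverse (real (Suc j))) < taboo_iter K {} (Suc m) (indicator A) y"
        by (metis ennreal_leI less_imp_le le_less_trans)
      then show "y \<in> (\<Union>m. \<Union>j. B m j)"
        by (auto simp: B_def)
    qed
    ultimately show False
      using \<open>emeasure \<nu> UNIV > 0\<close> by simp
  qed
  then obtain m j where "emeasure \<nu> (B m j) > 0"
    by blast
  \<comment> \<open>Half of the mass pays for the tail of \<open>a\<close>, half for the times
    before \<open>k\<close>. The cap at \<open>1\<close> keeps \<open>\<beta>\<close> finite even if
    \<open>\<nu>\<close> is not.\<close>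
  define \<beta> where "\<beta> = min 1 (emeasure \<nu> (B m j)) / 2"
  have \<beta>: "0 < \<beta>" "\<beta> < 1" "\<beta> + \<beta> \<le> emeasure \<nu> (B m j)"
  proof -
    have "min 1 (emeasure \<nu> (B m j)) > 0"
      using \<open>emeasure \<nu> (B m j) > 0\<close> by simp
    then show "0 < \<beta>"
      unfolding \<beta>_def by (simp add: ennreal_zero_less_divide)
    have "\<beta> \<le> 1 / 2"
      unfolding \<beta>_def by (intro divide_right_mono_ennreal) simp
    also have "\<dots> < (1::ennreal)"
      by (simp add: divide_less_ennreal)
    finally show "\<beta> < 1" .
    show "\<beta> + \<beta> \<le> emeasure \<nu> (B m j)"
      unfolding \<beta>_def mult_2[symmetric] ennreal_times_divide mult.commute[of 2]
      by (simp add: mult_divide_eq_ennreal)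
  qed
  have total: "(\<Sum>n. ennreal (pmf a n)) = 1"
  proof -
    have "(\<Sum>n. ennreal (pmf a n)) = (\<integral>\<^sup>+n. ennreal (pmf a n) \<partial>count_space UNIV)"
      by (rule nn_integral_count_space_nat[symmetric])
    also have "\<dots> = emeasure (measure_pmf a) UNIV"
      by (rule nn_integral_pmf)
    also have "\<dots> = 1"
      using measure_pmf.emeasure_space_1[of a] by simp
    finally show ?thesis .
  qed
  have "1 - \<beta> < (SUP k. \<Sum>n<k. ennreal (pmf a n))"
    unfolding suminf_eq_SUP[symmetric] total using \<beta> by (intro ennreal_between) auto
  then obtain k where k: "1 - \<beta> < (\<Sum>n<k. ennreal (pmf a n))"
    unfolding less_SUP_iff by blast
  have tail: "(\<Sum>n. ennreal (pmf a (n + k))) < \<beta>"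
  proof -
    have "(\<Sum>n. ennreal (pmf a (n + k))) + (\<Sum>n<k. ennreal (pmf a n)) = 1"
      unfolding total[symmetric] by (rule suminf_offset[symmetric]) (rule summableI)
    moreover have "1 = \<beta> + (1 - \<beta>)"
      using \<beta> by (simp add: add_diff_inverse_ennreal)
    ultimately have eq: "(\<Sum>n. ennreal (pmf a (n + k))) + (\<Sum>n<k. ennreal (pmf a n)) = \<beta> + (1 - \<beta>)"
      by simp
    show ?thesis
    proof (rule ccontr)
      assume "\<not> ?thesis"
      then have "\<beta> + (1 - \<beta>) \<le> (\<Sum>n. ennreal (pmf a (n + k))) + (1 - \<beta>)"
        by (intro add_right_mono) simp
      moreover have "(\<Sum>n. ennreal (pmf a (n + k))) \<noteq> \<infinity>"
        using eq \<beta> by (auto simp: add_diff_inverse_ennreal)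
      ultimately show False
        using k unfolding eq[symmetric] ennreal_add_left_cancel_le by simp
    qed
  qed
  \<comment> \<open>Otherwise the minorization fails: the times from \<open>k\<close> on contribute
    at most the tail, which is below \<open>\<beta>\<close>, and the earlier times at most
    \<open>\<beta>\<close>.\<close>
  have hit: "\<exists>n<k. taboo_iter K {} n (indicator (B m j)) x > \<beta>" if "x \<in> C" for x
  proof (rule ccontr)
    assume "\<not> ?thesis"
    then have le: "taboo_iter K {} n (indicator (B m j)) x \<le> \<beta>" if "n < k" for n
      using that by force
    have le_1: "taboo_iter K {} n (indicator (B m j)) x \<le> 1" for n
    proof -
      have "taboo_iter K {} n (indicator (B m j)) x \<le> taboo_iter K {} n (\<lambda>_. 1) x"
        by (rule taboo_iter_mono) (auto split: split_indicator)
      then show ?thesis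
        by (simp only: iter_const)
    qed
    have "\<beta> + \<beta> \<le> (\<Sum>n. ennreal (pmf a n) * taboo_iter K {} n (indicator (B m j)) x)"
      using \<beta>(3) by (rule order_trans) (rule minor[OF that], measurable)
    also have "\<dots> = (\<Sum>n. ennreal (pmf a (n + k)) * taboo_iter K {} (n + k) (indicator (B m j)) x)
        + (\<Sum>n<k. ennreal (pmf a n) * taboo_iter K {} n (indicator (B m j)) x)"
      by (rule suminf_offset) simp
    also have "\<dots> \<le> (\<Sum>n. ennreal (pmf a (n + k)) * 1) + (\<Sum>n<k. ennreal (pmf a n) * \<beta>)"
      by (intro add_mono suminf_le sum_mono mult_left_mono le_1 le) auto
    also have "\<dots> \<le> (\<Sum>n. ennreal (pmf a (n + k))) + 1 * \<beta>"
    proof -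
      have "(\<Sum>n<k. ennreal (pmf a n)) \<le> 1"
        unfolding total[symmetric] by (rule sum_le_suminf) auto
      then show ?thesis
        unfolding sum_distrib_right[symmetric] by (intro add_mono mult_right_mono) auto
    qed
    also have "\<dots> < \<beta> + \<beta>"
    proof -
      have "\<beta> \<noteq> \<infinity>"
        using \<beta>(2) by auto
      then have "\<beta> + (\<Sum>n. ennreal (pmf a (n + k))) < \<beta> + \<beta>"
        using tail unfolding ennreal_add_left_cancel_less by blast
      then show ?thesis
        by (simp only: mult_1 add.commute)
    qed
    finally show False by simp
  qed
  define \<epsilon> :: ennreal where "\<epsilon> = ennreal (inverse (real (Suc j))) * \<beta>"
  have "\<epsilon> > 0"
    using \<beta> by (simp add: \<epsilon>_def ennreal_zero_less_mult_iff)
  \<comment> \<open>The visit to \<open>B m j\<close> occurs at a time \<open>n < k\<close>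
    depending on \<open>x\<close>, but \<open>n + Suc m\<close> never exceeds the common horizon
    \<open>k + Suc m\<close>.\<close>
  have "taboo_iter K A (k + Suc m) (\<lambda>_. 1) x \<le> 1 - \<epsilon>" if x: "x \<in> C" for x
  proof -
    obtain n where n: "n < k" "taboo_iter K {} n (indicator (B m j)) x > \<beta>"
      using hit[OF x] by blast
    have "\<epsilon> \<le> ennreal (inverse (real (Suc j))) * taboo_iter K {} n (indicator (B m j)) x"
      unfolding \<epsilon>_def using n by (intro mult_left_mono) auto
    also have "\<dots> = taboo_iter K {} n (\<lambda>y. ennreal (inverse (real (Suc j))) * indicator (B m j) y) x"
      by (rule taboo_iter_cmult[symmetric]) auto
    also have "\<dots> \<le> taboo_iter K {} n (taboo_iter K {} (Suc m) (indicator A)) x"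
      by (rule taboo_iter_mono) (auto simp: B_def indicator_def simp del: funpow.simps)
    also have "\<dots> = taboo_iter K {} (n + Suc m) (indicator A) x"
      by (simp only: funpow_add comp_apply)
    finally have "taboo_iter K A (k + Suc m) (\<lambda>_. 1) x + \<epsilon>
        \<le> taboo_iter K A (k + Suc m) (\<lambda>_. 1) x + taboo_iter K {} (n + Suc m) (indicator A) x"
      by (rule add_left_mono)
    also have "\<dots> \<le> 1"
      using n by (intro taboo_iter_one_add_iter_indicator_le_1) auto
    finally show ?thesis
      by (simp add: ennreal_le_minus_iff)
  qed
  moreover have "1 - \<epsilon> < 1"
    using \<open>\<epsilon> > 0\<close> by (intro ennreal_between) auto
  ultimately show ?thesis
    by blast
qed

end

lemma suminf_indicator_less_enat_le:
  "(\<Sum>n. indicator {n. enat n < t} n) \<le> ennreal_of_enat t"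
proof (cases t)
  case (enat m)
  have "(\<Sum>n<k. indicator {n. enat n < t} n :: ennreal) = of_nat (min k m)" for k
    by (induction k) (auto simp: enat min_def add.commute)
  then show ?thesis
    by (simp add: suminf_eq_SUP SUP_le_iff enat of_nat_mono)
qed simp

section \<open>The chain and its kernel\<close>

sublocale markov_chain \<subseteq> borel_kernel "trans_kernel Pr X"
  by standard (rule kernel_measurable)

context markov_chain
begin

declare One_nat_def [simp del]

section \<open>Histories and the Markov property\<close>

lemma measurable_Pr [measurable]: "X n \<in> Pr x \<rightarrow>\<^sub>M borel"
  using X_measurable by (simp cong: measurable_cong_sets add: sets_Pr)

lemma history_generator_subset:
  "{X i -` B \<inter> space (Pr x) | i B. i \<le> n \<and> B \<in> sets borel} \<subseteq> sets (Pr x)"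
  by auto

lemma sets_history:
  "sets (history (Pr x) X n) =
    sigma_sets (space (Pr x)) {X i -` B \<inter> space (Pr x) | i B. i \<le> n \<and> B \<in> sets borel}"
  unfolding history_def by (rule sets_measure_of) auto

lemma sets_history_subset: "sets (history (Pr x) X n) \<subseteq> sets (Pr x)"
  unfolding sets_history by (rule sets.sigma_sets_subset[OF history_generator_subset])

text \<open>The history depends on its measure only through the space, so the one over
  \<open>\<Omega>\<close> serves for every \<open>Pr x\<close>.\<close>

lemma history_eq: "history \<Omega> X n = history (Pr x) X n"
  unfolding history_def using sets_eq_imp_space_eq[OF sets_Pr, of x] by simp

text \<open>The event \<open>\<tau>\<^sub>A > n\<close> is decided by time \<open>n\<close>, which
  makes the Markov property applicable on it.\<close>

lemma avoid_in_history:
  assumes "A \<in> sets borel"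
  shows "{\<omega>\<in>space (Pr x). \<forall>i\<in>{1..n}. X i \<omega> \<notin> A} \<in> sets (history (Pr x) X n)"
proof -
  have "space (history (Pr x) X n) = space (Pr x)"
    unfolding history_def by (simp add: space_measure_of_conv)
  moreover have "{\<omega>\<in>space (history (Pr x) X n). X i \<omega> \<notin> A} \<in> sets (history (Pr x) X n)" if "i \<in> {1..n}" for i
  proof -
    have "{\<omega>\<in>space (history (Pr x) X n). X i \<omega> \<notin> A} = X i -` (- A) \<inter> space (Pr x)"
      using calculation by auto
    then show ?thesis
      unfolding sets_history using that assms
      by (auto intro!: sigma_sets.Basic exI[of _ i] exI[of _ "- A"])
  qed
  ultimately show ?thesis
    using sets.sets_Collect_finite_All[of "{1..n}" "history (Pr x) X n" "\<lambda>i \<omega>. X i \<omega> \<notin> A"] by simp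
qed

text \<open>Integrate the conditional probability in \<open>markov\<close> over \<open>H\<close>.
  All integrands are bounded by \<open>1\<close>, so Bochner and nonnegative integrals
  agree.\<close>

lemma markov_nn_integral_indicator:
  assumes H: "H \<in> sets (history (Pr x) X n)" and [measurable]: "B \<in> sets borel"
  shows "(\<integral>\<^sup>+\<omega>. indicator B (X (Suc n) \<omega>) * indicator H \<omega> \<partial>Pr x)
    = (\<integral>\<^sup>+\<omega>. emeasure (trans_kernel Pr X (X n \<omega>)) B * indicator H \<omega> \<partial>Pr x)"
proof -
  interpret prob_space "Pr x" by (rule prob)
  interpret finite_measure_subalgebra "Pr x" "history (Pr x) X n"
    using sets_history_subset[of x n]
    by unfold_locales (auto simp: subalgebra_def history_def space_measure_of_conv)
  have [measurable]: "H \<in> sets (Pr x)"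
    using H sets_history_subset by blast
  have K_m [measurable]: "(\<lambda>y. measure (trans_kernel Pr X y) B) \<in> borel_measurable borel"
    using measurable_prob_algebraD[OF kernel] by measurable
  have int: "integrable (Pr x) (\<lambda>\<omega>. indicator B (X (Suc n) \<omega>) :: real)"
    by (rule integrable_const_bound[of _ 1]) (auto simp: indicator_def)
  have K_le: "measure (trans_kernel Pr X y) B \<le> 1" for y
    using prob_space_kernel by (rule prob_space.prob_le_1)
  have "(\<integral>\<omega>\<in>H. indicator B (X (Suc n) \<omega>) \<partial>Pr x)
      = (\<integral>\<omega>\<in>H. real_cond_exp (Pr x) (history (Pr x) X n) (\<lambda>\<omega>. indicator B (X (Suc n) \<omega>)) \<omega> \<partial>Pr x)"
    by (rule real_cond_exp_intA[OF int H])
  also have "\<dots> = (\<integral>\<omega>\<in>H. measure (trans_kernel Pr X (X n \<omega>)) B \<partial>Pr x)"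
    unfolding set_lebesgue_integral_def
    using markov[of B x n] by (intro integral_cong_AE) (auto simp: history_eq[of n x])
  finally have eq: "(\<integral>\<omega>. indicator B (X (Suc n) \<omega>) * indicator H \<omega> \<partial>Pr x)
      = (\<integral>\<omega>. measure (trans_kernel Pr X (X n \<omega>)) B * indicator H \<omega> \<partial>Pr x)"
    by (simp add: set_lebesgue_integral_def mult.commute)
  have "(\<integral>\<^sup>+\<omega>. indicator B (X (Suc n) \<omega>) * indicator H \<omega> \<partial>Pr x)
      = (\<integral>\<^sup>+\<omega>. ennreal (indicator B (X (Suc n) \<omega>) * indicator H \<omega>) \<partial>Pr x)"
    by (intro nn_integral_cong) (auto simp: indicator_def)
  also have "\<dots> = ennreal (\<integral>\<omega>. indicator B (X (Suc n) \<omega>) * indicator H \<omega> \<partial>Pr x)"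
    by (intro nn_integral_eq_integral integrable_const_bound[of _ 1]) (auto simp: indicator_def)
  also have "\<dots> = (\<integral>\<^sup>+\<omega>. ennreal (measure (trans_kernel Pr X (X n \<omega>)) B * indicator H \<omega>) \<partial>Pr x)"
    unfolding eq
    by (intro nn_integral_eq_integral[symmetric] integrable_const_bound[of _ 1])
       (auto simp: indicator_def K_le)
  also have "\<dots> = (\<integral>\<^sup>+\<omega>. emeasure (trans_kernel Pr X (X n \<omega>)) B * indicator H \<omega> \<partial>Pr x)"
    by (intro nn_integral_cong)
       (auto simp: indicator_def finite_measure.emeasure_eq_measure
          [OF prob_space.finite_measure[OF prob_space_kernel]])
  finally show ?thesis .
qed

lemma markov_nn_integral:
  assumes H: "H \<in> sets (history (Pr x) X n)" and [measurable]: "f \<in> borel_measurable borel"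
  shows "(\<integral>\<^sup>+\<omega>. f (X (Suc n) \<omega>) * indicator H \<omega> \<partial>Pr x)
    = (\<integral>\<^sup>+\<omega>. (\<integral>\<^sup>+y. f y \<partial>trans_kernel Pr X (X n \<omega>)) * indicator H \<omega> \<partial>Pr x)"
proof -
  have [measurable]: "H \<in> sets (Pr x)"
    using H sets_history_subset by blast
  have [measurable]: "trans_kernel Pr X \<in> borel \<rightarrow>\<^sub>M subprob_algebra borel"
    using kernel by (rule measurable_prob_algebraD)
  \<comment> \<open>The law of \<open>X k\<close> restricted to \<open>H\<close>. The indicator case
    says that \<open>\<mu> (Suc n)\<close> is \<open>\<mu> n\<close> followed by the kernel, and
    equal measures integrate all nonnegative functions alike.\<close>
  define \<mu> where "\<mu> k = distr (density (Pr x) (indicator H)) borel (X k)" for k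
  have sets_\<mu> [measurable_cong, simp]: "sets (\<mu> k) = sets borel" for k
    by (simp add: \<mu>_def)
  have nn_\<mu>: "(\<integral>\<^sup>+y. g y \<partial>\<mu> k) = (\<integral>\<^sup>+\<omega>. g (X k \<omega>) * indicator H \<omega> \<partial>Pr x)"
    if [measurable]: "g \<in> borel_measurable borel" for g k
    unfolding \<mu>_def by (subst nn_integral_distr) (auto simp: nn_integral_density mult.commute)
  have kernel_\<mu>: "trans_kernel Pr X \<in> \<mu> n \<rightarrow>\<^sub>M subprob_algebra borel"
    by measurable
  have space_\<mu>: "space (\<mu> n) \<noteq> {}"
    by (simp add: \<mu>_def)
  have "\<mu> (Suc n) = \<mu> n \<bind> trans_kernel Pr X"
  proof (rule measure_eqI)
    show sets: "sets (\<mu> (Suc n)) = sets (\<mu> n \<bind> trans_kernel Pr X)"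
      using sets_bind_measurable[OF kernel_\<mu> space_\<mu>] by simp
    fix B assume "B \<in> sets (\<mu> (Suc n))"
    then have [measurable]: "B \<in> sets borel" by simp
    have "emeasure (\<mu> (Suc n)) B = (\<integral>\<^sup>+y. indicator B y \<partial>\<mu> (Suc n))"
      by simp
    also have "\<dots> = (\<integral>\<^sup>+\<omega>. emeasure (trans_kernel Pr X (X n \<omega>)) B * indicator H \<omega> \<partial>Pr x)"
      using markov_nn_integral_indicator[OF H, of B] by (subst nn_\<mu>) auto
    also have "\<dots> = (\<integral>\<^sup>+y. emeasure (trans_kernel Pr X y) B \<partial>\<mu> n)"
      by (subst nn_\<mu>) auto
    also have "\<dots> = emeasure (\<mu> n \<bind> trans_kernel Pr X) B"
      by (rule emeasure_bind[OF space_\<mu> kernel_\<mu>, symmetric]) simp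
    finally show "emeasure (\<mu> (Suc n)) B = emeasure (\<mu> n \<bind> trans_kernel Pr X) B" .
  qed
  then have "(\<integral>\<^sup>+y. f y \<partial>\<mu> (Suc n)) = (\<integral>\<^sup>+z. (\<integral>\<^sup>+y. f y \<partial>trans_kernel Pr X z) \<partial>\<mu> n)"
    using nn_integral_bind[OF _ kernel_\<mu>, of f] by simp
  then show ?thesis
    by (simp add: nn_\<mu>)
qed

section \<open>Killed iterates as expectations along the chain\<close>

lemma taboo_iter_eq_nn_integral:
  assumes A [measurable]: "A \<in> sets borel" and "f \<in> borel_measurable borel"
  shows "taboo_iter (trans_kernel Pr X) A n f x =
    (\<integral>\<^sup>+\<omega>. f (X n \<omega>) * indicator {\<omega>\<in>space (Pr x). \<forall>i\<in>{1..n}. X i \<omega> \<notin> A} \<omega> \<partial>Pr x)"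
  using assms(2)
proof (induction n arbitrary: f)
  case 0
  have "(\<integral>\<^sup>+\<omega>. f (X 0 \<omega>) * indicator {\<omega>\<in>space (Pr x). \<forall>i\<in>{1..0}. X i \<omega> \<notin> A} \<omega> \<partial>Pr x)
      = (\<integral>\<^sup>+\<omega>. f x \<partial>Pr x)"
    using start[of x] by (intro nn_integral_cong_AE) auto
  then show ?case
    using prob_space.emeasure_space_1[OF prob, of x] by simp
next
  case (Suc n)
  let ?H = "\<lambda>n. {\<omega>\<in>space (Pr x). \<forall>i\<in>{1..n}. X i \<omega> \<notin> A}"
  note [measurable] = \<open>f \<in> borel_measurable borel\<close>
  \<comment> \<open>The last step of the path is peeled off and absorbed into the function, so the
    Markov property is applied at time \<open>n\<close> on
    \<open>\<tau>\<^sub>A > n\<close>.\<close>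
  have "taboo_iter (trans_kernel Pr X) A (Suc n) f x
      = taboo_iter (trans_kernel Pr X) A n (taboo (trans_kernel Pr X) A f) x"
    by (simp add: funpow_swap1)
  also have "\<dots> = (\<integral>\<^sup>+\<omega>. taboo (trans_kernel Pr X) A f (X n \<omega>) * indicator (?H n) \<omega> \<partial>Pr x)"
    by (rule Suc.IH) measurable
  also have "\<dots> = (\<integral>\<^sup>+\<omega>. (f (X (Suc n) \<omega>) * indicator (- A) (X (Suc n) \<omega>)) * indicator (?H n) \<omega> \<partial>Pr x)"
    unfolding taboo_def
    by (rule markov_nn_integral[OF avoid_in_history[OF A], symmetric]) measurable
  also have "\<dots> = (\<integral>\<^sup>+\<omega>. f (X (Suc n) \<omega>) * indicator (?H (Suc n)) \<omega> \<partial>Pr x)"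
    by (intro nn_integral_cong) (auto simp: indicator_def atLeastAtMostSuc_conv)
  finally show ?case .
qed

text \<open>Chapman-Kolmogorov: \<open>nstep\<close> is defined as the law of \<open>X n\<close>,
  and this identifies it with the \<open>n\<close>-th power of the kernel.\<close>

lemma emeasure_nstep:
  assumes [measurable]: "B \<in> sets borel"
  shows "emeasure (nstep Pr X n x) B = taboo_iter (trans_kernel Pr X) {} n (indicator B) x"
proof -
  have "taboo_iter (trans_kernel Pr X) {} n (indicator B) x = (\<integral>\<^sup>+\<omega>. indicator (X n -` B \<inter> space (Pr x)) \<omega> \<partial>Pr x)"
    by (subst taboo_iter_eq_nn_integral, measurable, rule nn_integral_cong) (auto split: split_indicator)
  then show ?thesis
    by (simp add: nstep_def emeasure_distr)
qed

lemma taboo_iter_one_eq_emeasure: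
  assumes [measurable]: "A \<in> sets borel"
  shows "taboo_iter (trans_kernel Pr X) A n (\<lambda>_. 1) x =
    emeasure (Pr x) {\<omega>\<in>space (Pr x). \<forall>i\<in>{1..n}. X i \<omega> \<notin> A}"
  by (subst taboo_iter_eq_nn_integral) auto

text \<open>Tail summation: avoiding \<open>A\<close> at the times \<open>1\<close> to
  \<open>n\<close> forces a return time of at least \<open>n + 1\<close>. It carries the ergodicity
  bound over to \<open>mean_return\<close>.\<close>

lemma mean_return_le_nn_integral:
  assumes [measurable]: "A \<in> sets borel"
  shows "mean_return (trans_kernel Pr X) A x \<le> (\<integral>\<^sup>+\<omega>. ennreal_of_enat (return_time X A \<omega>) \<partial>Pr x)"
proof -
  let ?H = "\<lambda>n. {\<omega>\<in>space (Pr x). \<forall>i\<in>{1..n}. X i \<omega> \<notin> A}"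
  have "mean_return (trans_kernel Pr X) A x = (\<integral>\<^sup>+\<omega>. (\<Sum>n. indicator (?H n) \<omega>) \<partial>Pr x)"
    unfolding mean_return_def by (subst nn_integral_suminf) (auto simp: taboo_iter_one_eq_emeasure)
  also have "\<dots> \<le> (\<integral>\<^sup>+\<omega>. (\<Sum>n. indicator {n. enat n < return_time X A \<omega>} n) \<partial>Pr x)"
  proof (intro nn_integral_mono suminf_le)
    fix \<omega> n
    have "enat n < return_time X A \<omega>" if "\<forall>i\<in>{1..n}. X i \<omega> \<notin> A"
    proof -
      have "eSuc (enat n) \<le> return_time X A \<omega>"
        unfolding return_time_def using that
        by (intro INF_greatest) (force simp: eSuc_enat not_less_eq_eq[symmetric])
      then show ?thesis
        by (metis eSuc_enat enat_ord_simps(2) lessI less_le_trans)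
    qed
    then show "indicator (?H n) \<omega> \<le> (indicator {n. enat n < return_time X A \<omega>} n :: ennreal)"
      by (auto simp: indicator_def)
  qed auto
  also have "\<dots> \<le> (\<integral>\<^sup>+\<omega>. ennreal_of_enat (return_time X A \<omega>) \<partial>Pr x)"
    by (intro nn_integral_mono suminf_indicator_less_enat_le)
  finally show ?thesis .
qed

text \<open>Infinitely many visits include at least one, so the decreasing events
  \<open>\<tau>\<^sub>A > n\<close> have a null intersection.\<close>

lemma harris_recurrent_taboo_iter_tendsto_0:
  assumes "harris_recurrent Pr X \<psi>" and "A \<in> Bplus \<psi>"
  shows "(\<lambda>n. taboo_iter (trans_kernel Pr X) A n (\<lambda>_. 1) x) \<longlonglongrightarrow> 0"
proof -
  interpret prob_space "Pr x" by (rule prob)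
  have [measurable]: "A \<in> sets borel"
    using \<open>A \<in> Bplus \<psi>\<close> by (simp add: Bplus_def)
  let ?H = "\<lambda>n. {\<omega>\<in>space (Pr x). \<forall>i\<in>{1..n}. X i \<omega> \<notin> A}"
  have "\<P>(\<omega> in Pr x. (\<Sum>n. indicator A (X (Suc n) \<omega>)) = (\<infinity>::ennreal)) = 1"
    using assms by (simp add: harris_recurrent_def)
  then have "AE \<omega> in Pr x. (\<Sum>n. indicator A (X (Suc n) \<omega>)) = (\<infinity>::ennreal)"
    by (subst (asm) prob_Collect_eq_1) measurable
  then have "AE \<omega> in Pr x. \<omega> \<notin> (\<Inter>n. ?H n)"
  proof eventually_elim
    case (elim \<omega>)
    show ?case
    proof
      assume "\<omega> \<in> (\<Inter>n. ?H n)"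
      then have "X (Suc n) \<omega> \<notin> A" for n
        by (force dest!: INT_D[of _ _ _ "Suc n"])
      with elim show False by simp
    qed
  qed
  then have "emeasure (Pr x) (\<Inter>n. ?H n) = 0"
    by (subst (asm) AE_iff_measurable[of "\<Inter>n. ?H n"]) (auto simp del: INT_iff)
  moreover have "(\<lambda>n. emeasure (Pr x) (?H n)) \<longlonglongrightarrow> emeasure (Pr x) (\<Inter>n. ?H n)"
    by (rule Lim_emeasure_decseq) (auto simp: decseq_def)
  ultimately show ?thesis
    by (simp add: taboo_iter_one_eq_emeasure)
qed

end

section \<open>From extended real integrals to nonnegative ones\<close>

text \<open>Dropping the negative part only enlarges the right side, so the positive part of a drift
  function satisfies the inequality among nonnegative functions.\<close>

lemma ennreal_le_1_plus_of_ext_set_integral: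
  assumes "ereal (c - 1) \<le> ext_set_integral M S f"
  shows "ennreal c \<le> 1 + (\<integral>\<^sup>+y\<in>S. ennreal (f y) \<partial>M)"
proof -
  let ?p = "\<integral>\<^sup>+y\<in>S. ennreal (f y) \<partial>M"
  have "ereal (c - 1) \<le> enn2ereal ?p"
  proof -
    have "enn2ereal ?p - enn2ereal q \<le> enn2ereal ?p" for q
      by (intro ereal_diff_le_self) simp
    then show ?thesis
      using assms unfolding ext_set_integral_def by (rule order_trans[rotated])
  qed
  then show ?thesis
    by (cases ?p) (auto simp flip: ennreal_1 ennreal_plus intro!: ennreal_leI)
qed

lemma ereal_SUP_less_top_obtains_bound:
  fixes f :: "'a \<Rightarrow> real"
  assumes "(SUP x\<in>S. ereal (f x)) < \<infinity>"
  obtains M where "\<And>x. x \<in> S \<Longrightarrow> f x \<le> M"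
proof -
  obtain M where "(SUP x\<in>S. ereal (f x)) < ereal M"
    using assms ereal_dense2 by blast
  then have "f x \<le> M" if "x \<in> S" for x
    using SUP_upper[OF that, of "\<lambda>x. ereal (f x)"] by (metis ereal_less_eq(3) less_imp_le order_trans)
  then show ?thesis by (rule that)
qed

section \<open>Non-ergodicity\<close>

theorem corollary1p2:
  fixes \<Omega> :: "'w measure"
    and Pr :: "'a::{metric_space, second_countable_topology} \<Rightarrow> 'w measure"
    and X :: "nat \<Rightarrow> 'w \<Rightarrow> 'a"
    and \<psi> :: "'a measure"
    and A :: "'a set"
    and V :: "nat \<Rightarrow> 'a \<Rightarrow> real"
  assumes "locally compact (UNIV :: 'a set)"
    and "markov_chain \<Omega> Pr X"
    and "maximal_irreducibility_measure Pr X \<psi>"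
    and "harris_recurrent Pr X \<psi>"
    and "aperiodic (trans_kernel Pr X) \<psi>"
    and "feller (trans_kernel Pr X)"
    and "interior (measure_support \<psi>) \<noteq> {}"
    and "A \<in> Bplus \<psi>"
    and "\<And>n. n \<ge> 1 \<Longrightarrow> V n \<in> borel_measurable borel"
    and "\<And>n. n \<ge> 1 \<Longrightarrow> (SUP x\<in>-A. ereal (V n x)) < \<infinity>"
    and "((\<forall>x. \<forall>n\<ge>1. ext_set_integral (trans_kernel Pr X x) (-A) (V n) \<ge> ereal (V n x - 1)) \<and>
          (\<exists>B\<in>Bplus \<psi>. {x\<in>B. (SUP n\<in>{1..}. ereal (V n x)) = \<infinity>} \<in> Bplus \<psi>))
       \<or> ((\<forall>x\<in>-A. \<forall>n\<ge>1. ext_set_integral (trans_kernel Pr X x) (-A) (V n) \<ge> ereal (V n x - 1)) \<and>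
          (\<exists>B\<in>Bplus \<psi>. B \<subseteq> -A \<and> {x\<in>B. (SUP n\<in>{1..}. ereal (V n x)) = \<infinity>} \<in> Bplus \<psi>))"
  shows "\<not> ergodic_chain Pr X \<psi>"
proof
  assume "ergodic_chain Pr X \<psi>"
  interpret markov_chain \<Omega> Pr X by fact
  let ?K = "trans_kernel Pr X"
  have [measurable]: "A \<in> sets borel"
    using \<open>A \<in> Bplus \<psi>\<close> by (simp add: Bplus_def)
  have reach: "(\<Sum>n. taboo_iter ?K {} (Suc n) (indicator B) x) > 0" if "B \<in> Bplus \<psi>" for B x
    using that assms(3)
    by (simp add: maximal_irreducibility_measure_def irreducibility_measure_def Bplus_def
        emeasure_nstep del: funpow.simps)
  have sets_\<psi>: "sets \<psi> = sets borel"
    using assms(3) by (simp add: maximal_irreducibility_measure_def irreducibility_measure_def)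
  obtain C where C: "C \<in> Bplus \<psi>" "petite Pr X C"
    and "(SUP x\<in>C. \<integral>\<^sup>+\<omega>. ennreal_of_enat (return_time X C \<omega>) \<partial>Pr x) < \<infinity>"
    using \<open>ergodic_chain Pr X \<psi>\<close> by (auto simp: ergodic_chain_def)
  then obtain M where "M < \<top>"
    and M: "x \<in> C \<Longrightarrow> (\<integral>\<^sup>+\<omega>. ennreal_of_enat (return_time X C \<omega>) \<partial>Pr x) \<le> M" for x
    by (metis SUP_upper infinity_ennreal_def)
  have [measurable]: "C \<in> sets borel"
    using C by (simp add: Bplus_def)
  have mean_C: "mean_return ?K C x \<le> M" if "x \<in> C" for x
    using mean_return_le_nn_integral M[OF that] by (rule order_trans) measurable
  obtain a :: "nat pmf" and \<nu> :: "'a measure" where "sets \<nu> = sets borel" "emeasure \<nu> UNIV > 0"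
    and "\<And>x B. x \<in> C \<Longrightarrow> B \<in> sets borel \<Longrightarrow>
      emeasure \<nu> B \<le> (\<Sum>n. ennreal (pmf a n) * emeasure (nstep Pr X n x) B)"
    using \<open>petite Pr X C\<close> unfolding petite_def by blast
  then have "\<exists>N q. q < 1 \<and> (\<forall>x\<in>C. taboo_iter ?K A N (\<lambda>_. 1) x \<le> q)"
    by (intro uniform_hitting_of_petite[of A \<nu> C a] reach \<open>A \<in> Bplus \<psi>\<close>) (auto simp: emeasure_nstep)
  then obtain N q where "q < 1" and q: "\<And>x. x \<in> C \<Longrightarrow> taboo_iter ?K A N (\<lambda>_. 1) x \<le> q"
    by blast
  then obtain c where "c < \<top>" and c: "\<And>x. mean_return ?K A x \<le> mean_return ?K C x + c"
    using mean_return_comparison[of A C M N q] mean_C \<open>M < \<top>\<close> by auto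
  \<comment> \<open>Drift off \<open>A\<close> and at \<open>x\<close> itself serves both
    alternatives: in (a) it holds everywhere, in (b) the points \<open>x\<close> of interest lie off
    \<open>A\<close>.\<close>
  have V_le: "ennreal (V n x) \<le> mean_return ?K A x"
    if drift: "\<And>y. y \<notin> A \<or> y = x \<Longrightarrow> ext_set_integral (?K y) (-A) (V n) \<ge> ereal (V n y - 1)"
      and "n \<ge> 1" for n x
  proof -
    obtain m where "\<And>y. y \<in> -A \<Longrightarrow> V n y \<le> m"
      using assms(10)[OF \<open>n \<ge> 1\<close>] by (rule ereal_SUP_less_top_obtains_bound) blast
    moreover have "ennreal (V n y) \<le> 1 + taboo ?K A (\<lambda>z. ennreal (V n z)) y" if "y \<notin> A \<or> y = x" for y
      unfolding taboo_def by (rule ennreal_le_1_plus_of_ext_set_integral[OF drift[OF that]])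
    ultimately show ?thesis
      by (intro le_mean_return[where M = "ennreal m"] harris_recurrent_taboo_iter_tendsto_0[OF assms(4,8)])
         (auto intro: ennreal_leI)
  qed
  define S where "S = {x. mean_return ?K C x = \<top>}"
  have S_borel: "S \<in> sets borel"
  proof -
    have "S = {x\<in>space borel. mean_return ?K C x = \<top>}"
      by (simp add: S_def)
    also have "\<dots> \<in> sets borel"
      by measurable
    finally show ?thesis .
  qed
  \<comment> \<open>An infinite supremum forces an infinite mean return time to \<open>A\<close>;
    the comparison with constant \<open>c\<close> passes this on to \<open>C\<close>.\<close>
  have in_S: "x \<in> S"
    if "(SUP n\<in>{1..}. ereal (V n x)) = \<infinity>" and le: "\<And>n. n \<ge> 1 \<Longrightarrow> ennreal (V n x) \<le> mean_return ?K A x" for x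
  proof -
    have "mean_return ?K A x = \<top>"
    proof (rule ccontr)
      assume "mean_return ?K A x \<noteq> \<top>"
      then obtain r where r: "mean_return ?K A x = ennreal r" "r \<ge> 0"
        by (cases "mean_return ?K A x") auto
      have "(SUP n\<in>{1..}. ereal (V n x)) \<le> ereal r"
        using le r by (intro SUP_least) (auto simp: ennreal_le_iff)
      with that(1) show False by simp
    qed
    with c[of x] \<open>c < \<top>\<close> show ?thesis
      by (auto simp: S_def top_unique)
  qed
  have "\<exists>B\<in>Bplus \<psi>. B \<subseteq> S"
    using assms(11)
  proof (elim disjE conjE bexE)
    fix B
    assume drift: "\<forall>x. \<forall>n\<ge>1. ext_set_integral (?K x) (-A) (V n) \<ge> ereal (V n x - 1)"
      and "{x\<in>B. (SUP n\<in>{1..}. ereal (V n x)) = \<infinity>} \<in> Bplus \<psi>"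
    moreover have "{x\<in>B. (SUP n\<in>{1..}. ereal (V n x)) = \<infinity>} \<subseteq> S"
      using drift by (auto intro!: in_S V_le)
    ultimately show ?thesis by blast
  next
    fix B
    assume drift: "\<forall>x\<in>-A. \<forall>n\<ge>1. ext_set_integral (?K x) (-A) (V n) \<ge> ereal (V n x - 1)"
      and "B \<subseteq> -A" and "{x\<in>B. (SUP n\<in>{1..}. ereal (V n x)) = \<infinity>} \<in> Bplus \<psi>"
    moreover have "{x\<in>B. (SUP n\<in>{1..}. ereal (V n x)) = \<infinity>} \<subseteq> S"
      using drift \<open>B \<subseteq> -A\<close> by (auto intro!: in_S V_le)
    ultimately show ?thesis by blast
  qed
  then obtain B where "B \<in> Bplus \<psi>" "B \<subseteq> S"
    by blast
  then have "emeasure \<psi> B \<le> emeasure \<psi> S"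
    using S_borel by (intro emeasure_mono) (auto simp: sets_\<psi>)
  with \<open>B \<in> Bplus \<psi>\<close> S_borel have "S \<in> Bplus \<psi>"
    by (auto simp: Bplus_def)
  \<comment> \<open>Positive \<open>\<psi>\<close>-measure makes \<open>C\<close> nonempty. From a
    point of \<open>C\<close> irreducibility would reach \<open>S\<close>, while every iterate gives
    \<open>S\<close> probability \<open>0\<close>.\<close>
  obtain x where "x \<in> C"
    using C by (fastforce simp: Bplus_def)
  have fin: "mean_return ?K C y < \<top>" if "y \<in> C" for y
    using mean_C[OF that] \<open>M < \<top>\<close> by (rule le_less_trans)
  have "taboo_iter ?K {} (Suc n) (indicator S) x = 0" for n
    unfolding S_def by (intro iter_infinite_mean_return_eq_0 fin \<open>x \<in> C\<close>) measurable
  then show False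
    using reach[OF \<open>S \<in> Bplus \<psi>\<close>, of x] by (simp del: funpow.simps)
qed

end
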